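(* Consider the discretization and the parabolic update $\mathbf u^{\mathrm h,n}\mapsto\mathbf u^{n+1}$ described in the context. Assume $\mathbf u^{\mathrm h,n}_i\in\mathcal A(b)$ for all $i\in\mathcal V$ and let $T^*=(T_i^* )_{i\in\mathcal V}$ satisfy $T_i^*>0$ for all $i\in\mathcal V$. Then: (i) for every $\tau>0$ the system (P1)--(P2) (see context) for $(T_i^{n+1},E_{\mathrm r,i}^{n+1})_{i\in\mathcal V}$ is linear and has a unique solution; (ii) the update $\mathbf u^{\mathrm h,n}\mapsto\mathbf u^{n+1}$ is invariant-domain preserving for all $\tau>0$, i.e. $\mathbf u_i^{n+1}\in\mathcal A(b)$ for all $i\in\mathcal V$; (iii) the update $\mathbf u^{\mathrm h,n}\mapsto\mathbf u^{n+1}$ is conservative, i.e. $\sum_{i}m_i\rho_i^{n+1}=\sum_{i}m_i\rho_i^{\mathrm h,n}$, $\sum_{i}m_i\mathbf m_i^{n+1}=\sum_{i}m_i\mathbf m_i^{\mathrm h,n}$ and $\sum_{i}m_iE_{\mathrm{tot},i}^{n+1}=\sum_{i}m_iE_{\mathrm{tot},i}^{\mathrm h,n}$, where all sums are over $i\in\mathcal V$.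
   Context: **States.** $d\in\{1,2,3\}$; states are $\mathbf u=(\rho,\mathbf m^{T},E_{\mathrm m},E_{\mathrm r})^{T}\in\mathbb R^{d+3}$; $\mathbf v=\mathbf m/\rho$, $e(\mathbf u)=\rho^{-1}E_{\mathrm m}-\frac12\|\mathbf v\|^2$, $E_{\mathrm{tot}}=E_{\mathrm m}+E_{\mathrm r}$. Fix $b\ge0$ and a cold curve $e_{\mathrm{cold}}:(0,1/b)\to\mathbb R$ (with $1/b=\infty$ if $b=0$), assumed quasiconcave. Set $\mathcal B(b)=\{\mathbf u:\rho>0,\ 1-b\rho>0,\ e(\mathbf u)>e_{\mathrm{cold}}(\rho)\}$ and $\mathcal A(b)=\{\mathbf u\in\mathcal B(b):E_{\mathrm r}>0\}$. The temperature $T(\mathbf u)=T(\rho,e)\ge0$, defined on $\mathcal B(b)$, satisfies $e(\mathbf u)=c_{\mathrm v}(\rho,T(\mathbf u))T(\mathbf u)+e_{\mathrm{cold}}(\rho)$, where $c_{\mathrm v}(\rho,T)>0$ is the average heat capacity at constant volume ($c_{\mathrm v}(\rho,T)=\frac1T\int_0^T\mathfrak c_{\mathrm v}(\rho,\theta)\,d\theta$ with $\mathfrak c_{\mathrm v}>0$). The absorption cross section is a given function $\sigma_{\mathrm a}(\rho,T)\ge0$. $c>0$ (speed of light) and $a_{\mathrm r}>0$ (radiation constant) are constants. **Discretization.** $\mathcal V$ is a finite index set; each $i\in\mathcal V$ has a stencil $\mathcal V(i)\ni i$, with $j\in\mathcal V(i)$ iff $i\in\mathcal V(j)$; $\mathcal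 V^*(i)=\mathcal V(i)\setminus\{i\}$; masses $m_i>0$. For each density and temperature distribution $(\rho,T)$ there is a real matrix $\mathbb K(\rho,T)=(k_{ij}(\rho,T))_{i,j\in\mathcal V}$, with $k_{ij}=0$ if $j\notin\mathcal V(i)$, $k_{ij}=k_{ji}$ for all $i,j$, $k_{ij}\le0$ for $j\in\mathcal V^*(i)$, and $\sum_{j\in\mathcal V(i)}k_{ij}=0$ for all $i$ (it approximates the diffusion operator $E\mapsto-\nabla\cdot(\frac{c}{3\sigma_{\mathrm t}(\rho,T)}\nabla E)$). **Parabolic update.** Given $\mathbf u^{\mathrm h,n}=\{\mathbf u_i^{\mathrm h,n}\}_{i\in\mathcal V}$, set $T_i^{\mathrm h,n}=T(\mathbf u_i^{\mathrm h,n})$. Given $T^*$ positive and $\tau>0$, solve for $(T_i^{n+1},E_{\mathrm r,i}^{n+1})_{i\in\mathcal V}$: $$\rho_i^{\mathrm h,n}\big(c_{\mathrm v}(\rho_i^{\mathrm h,n},T_i^* )T_i^{n+1}-c_{\mathrm v}(\rho_i^{\mathrm h,n},T_i^{\mathrm h,n})T_i^{\mathrm h,n}\big)=-\tau\,\sigma_{\mathrm a}(\rho_i^{\mathrm h,n},T_i^* )\,c\,\big(a_{\mathrm r}(T_i^* )^3T_i^{n+1}-E_{\mathrm r,i}^{n+1}\big),\qquad(\mathrm P1)$$ $$m_i\big(E_{\mathrm r,i}^{n+1}-E_{\mathrm r,i}^{\mathrm h,n}\big)+\tau\big(\mathbb K(\rho^{\mathrm h,n},T^* )E_{\mathrm r}^{n+1}\big)_i=\tau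 m_i\,\sigma_{\mathrm a}(\rho_i^{\mathrm h,n},T_i^* )\,c\,\big(a_{\mathrm r}(T_i^* )^3T_i^{n+1}-E_{\mathrm r,i}^{n+1}\big).\qquad(\mathrm P2)$$ Then set $\rho_i^{n+1}=\rho_i^{\mathrm h,n}$, $\mathbf m_i^{n+1}=\mathbf m_i^{\mathrm h,n}$, $\mathbf v_i^{n+1}=\mathbf m_i^{n+1}/\rho_i^{n+1}$, $e_i^{n+1}=c_{\mathrm v}(\rho_i^{n+1},T_i^* )T_i^{n+1}+e_{\mathrm{cold}}(\rho_i^{\mathrm h,n})$, $E_{\mathrm m,i}^{n+1}=\rho_i^{n+1}\big(e_i^{n+1}+\frac12\|\mathbf v_i^{n+1}\|^2\big)$, and $\mathbf u_i^{n+1}=(\rho_i^{n+1},(\mathbf m_i^{n+1})^T,E_{\mathrm m,i}^{n+1},E_{\mathrm r,i}^{n+1})^T$. *)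

theory Defs
  imports "HOL-Analysis.Analysis"
begin

(* A state (rho, m, E_m, E_r) in R^(d+3), with d = CARD('d). *)
type_synonym 'd state = "real \<times> (real ^ 'd) \<times> real \<times> real"

definition mass_density :: "('d::finite) state \<Rightarrow> real"
  where "mass_density u = fst u"

definition momentum :: "('d::finite) state \<Rightarrow> real ^ 'd"
  where "momentum u = fst (snd u)"

definition material_energy :: "('d::finite) state \<Rightarrow> real"
  where "material_energy u = fst (snd (snd u))"

definition radiation_energy :: "('d::finite) state \<Rightarrow> real"
  where "radiation_energy u = snd (snd (snd u))"

definition total_energy :: "('d::finite) state \<Rightarrow> real"
  where "total_energy u = material_energy u + radiation_energy u"

definition velocity :: "('d::finite) state \<Rightarrow> real ^ 'd"
  where "velocity u = momentum u /\<^sub>R mass_density u"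

definition internal_energy :: "('d::finite) state \<Rightarrow> real"
  where "internal_energy u = material_energy u / mass_density u - (1/2) * (norm (velocity u))\<^sup>2"

(* For b >= 0 this is the interval (0, 1/b), read as (0, infinity) when b = 0. *)
definition density_range :: "real \<Rightarrow> real set"
  where "density_range b = {r. 0 < r \<and> 0 < 1 - b * r}"

definition quasiconcave_on :: "real set \<Rightarrow> (real \<Rightarrow> real) \<Rightarrow> bool"
  where "quasiconcave_on S f \<longleftrightarrow> convex S \<and>
    (\<forall>x\<in>S. \<forall>y\<in>S. \<forall>t\<in>{0..1}. min (f x) (f y) \<le> f ((1 - t) * x + t * y))"

definition material_admissible :: "real \<Rightarrow> (real \<Rightarrow> real) \<Rightarrow> ('d::finite) state set"
  where "material_admissible b e_cold =
    {u. 0 < mass_density u \<and> 0 < 1 - b * mass_density u \<and> e_cold (mass_density u) < internal_energy u}"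

definition admissible :: "real \<Rightarrow> (real \<Rightarrow> real) \<Rightarrow> ('d::finite) state set"
  where "admissible b e_cold = {u \<in> material_admissible b e_cold. 0 < radiation_energy u}"

(* Average of an instantaneous heat capacity g(rho, theta) over [0, T]; meaningful for T > 0 only. *)
definition avg_heat_capacity :: "(real \<Rightarrow> real \<Rightarrow> real) \<Rightarrow> real \<Rightarrow> real \<Rightarrow> real"
  where "avg_heat_capacity g r T = (1 / T) * integral {0..T} (g r)"

definition temperature :: "(real \<Rightarrow> real \<Rightarrow> real) \<Rightarrow> ('d::finite) state \<Rightarrow> real"
  where "temperature Temp u = Temp (mass_density u) (internal_energy u)"

definition density_vec :: "('v::finite \<Rightarrow> ('d::finite) state) \<Rightarrow> real ^ 'v"
  where "density_vec U = (\<chi> i. mass_density (U i))"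

(* sigma_a c (a_r (T_i^* )^3 T_i - E_i), the source term shared by both equations. *)
definition exchange ::
  "real \<Rightarrow> real \<Rightarrow> (real \<Rightarrow> real \<Rightarrow> real) \<Rightarrow> ('v::finite \<Rightarrow> ('d::finite) state) \<Rightarrow> real ^ 'v
    \<Rightarrow> real ^ 'v \<Rightarrow> real ^ 'v \<Rightarrow> 'v \<Rightarrow> real"
  where "exchange c a_r \<sigma>_a U Tstar T E i =
    \<sigma>_a (mass_density (U i)) (Tstar $ i) * c * (a_r * (Tstar $ i) ^ 3 * T $ i - E $ i)"

(* The two sides of the parabolic system as maps of the unknown (T, E): the first component of the
   pair collects the material energy equations, the second one the radiation energy equations. *)
definition parabolic_lhs ::
  "(real \<Rightarrow> real \<Rightarrow> real) \<Rightarrow> (real \<Rightarrow> real \<Rightarrow> real) \<Rightarrow> ('v::finite \<Rightarrow> real)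
    \<Rightarrow> (real ^ 'v \<Rightarrow> real ^ 'v \<Rightarrow> real ^ 'v ^ 'v) \<Rightarrow> real \<Rightarrow> ('v \<Rightarrow> ('d::finite) state) \<Rightarrow> real ^ 'v
    \<Rightarrow> (real ^ 'v) \<times> (real ^ 'v) \<Rightarrow> (real ^ 'v) \<times> (real ^ 'v)"
  where "parabolic_lhs c_v Temp m K \<tau> U Tstar = (\<lambda>(T, E).
    (\<chi> i. mass_density (U i) *
         (c_v (mass_density (U i)) (Tstar $ i) * T $ i
          - c_v (mass_density (U i)) (temperature Temp (U i)) * temperature Temp (U i)),
     \<chi> i. m i * (E $ i - radiation_energy (U i)) + \<tau> * (K (density_vec U) Tstar *v E) $ i))"

definition parabolic_rhs ::
  "real \<Rightarrow> real \<Rightarrow> (real \<Rightarrow> real \<Rightarrow> real) \<Rightarrow> ('v::finite \<Rightarrow> real) \<Rightarrow> real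
    \<Rightarrow> ('v \<Rightarrow> ('d::finite) state) \<Rightarrow> real ^ 'v
    \<Rightarrow> (real ^ 'v) \<times> (real ^ 'v) \<Rightarrow> (real ^ 'v) \<times> (real ^ 'v)"
  where "parabolic_rhs c a_r \<sigma>_a m \<tau> U Tstar = (\<lambda>(T, E).
    (\<chi> i. - \<tau> * exchange c a_r \<sigma>_a U Tstar T E i,
     \<chi> i. \<tau> * m i * exchange c a_r \<sigma>_a U Tstar T E i))"

(* The equation F x = G x is linear in x: collecting terms gives L x = r with L linear. *)
definition linear_equation :: "('a::real_vector \<Rightarrow> 'b::real_vector) \<Rightarrow> ('a \<Rightarrow> 'b) \<Rightarrow> bool"
  where "linear_equation F G \<longleftrightarrow> (\<exists>L r. linear L \<and> (\<forall>x. F x - G x = L x - r))"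

definition updated_state ::
  "(real \<Rightarrow> real \<Rightarrow> real) \<Rightarrow> (real \<Rightarrow> real) \<Rightarrow> ('v::finite \<Rightarrow> ('d::finite) state) \<Rightarrow> real ^ 'v
    \<Rightarrow> (real ^ 'v) \<times> (real ^ 'v) \<Rightarrow> 'v \<Rightarrow> 'd state"
  where "updated_state c_v e_cold U Tstar = (\<lambda>(T, E) i.
    let \<rho> = mass_density (U i);
        mom = momentum (U i);
        v = mom /\<^sub>R \<rho>;
        e = c_v \<rho> (Tstar $ i) * T $ i + e_cold \<rho>
    in (\<rho>, mom, \<rho> * (e + (1/2) * (norm v)\<^sup>2), E $ i))"

(* The relation between the old states U and the new states U': U' is built from a solution of the
   parabolic system. *)
definition parabolic_update ::
  "real \<Rightarrow> real \<Rightarrow> (real \<Rightarrow> real \<Rightarrow> real) \<Rightarrow> (real \<Rightarrow> real \<Rightarrow> real) \<Rightarrow> (real \<Rightarrow> real)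
    \<Rightarrow> (real \<Rightarrow> real \<Rightarrow> real) \<Rightarrow> ('v::finite \<Rightarrow> real) \<Rightarrow> (real ^ 'v \<Rightarrow> real ^ 'v \<Rightarrow> real ^ 'v ^ 'v)
    \<Rightarrow> real \<Rightarrow> real ^ 'v \<Rightarrow> ('v \<Rightarrow> ('d::finite) state) \<Rightarrow> ('v \<Rightarrow> 'd state) \<Rightarrow> bool"
  where "parabolic_update c a_r \<sigma>_a c_v e_cold Temp m K \<tau> Tstar U U' \<longleftrightarrow>
    (\<exists>x. parabolic_lhs c_v Temp m K \<tau> U Tstar x = parabolic_rhs c a_r \<sigma>_a m \<tau> U Tstar x \<and>
         U' = updated_state c_v e_cold U Tstar x)"

end

theory Submission
  imports Defs
begin

text \<open>
  With the coefficients evaluated at the old density and at \<open>Tstar\<close>, the material and radiation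
  energy equations form a system \<open>L (T, E) = (f, g)\<close> with \<open>L\<close> linear (\<open>radiation_exchange.operator\<close>).
  Here \<open>f\<close> is the density times the excess of the old internal energy over the cold curve and \<open>g\<close> is
  the mass times the old radiation energy; both are positive on admissible states.

  The heart of the argument is a discrete minimum principle, \<open>rhs_le_at_nonpos_min\<close>. Let \<open>M\<close> be the time
  step times the diffusion matrix. At a cell \<open>i\<close> where \<open>E\<close> is minimal, the sign of the off-diagonal
  entries and the vanishing row sums give \<open>(M *v E) $ i \<le> 0\<close>. If moreover \<open>E $ i \<le> 0\<close> and \<open>0 \<le> f $ i\<close>,
  then by the material energy equation radiation does not lose energy to matter in cell \<open>i\<close>, and the
  radiation energy equation yields \<open>g $ i \<le> m i * E $ i\<close>. Hence nonnegative data have nonnegative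
  solutions (\<open>operator_inverse_nonneg\<close>) and positive data have positive solutions
  (\<open>operator_inverse_pos\<close>), where the sign of \<open>T\<close> follows from that of \<open>E\<close> by the material energy
  equation.

  Nonnegativity, applied to an element of the kernel and to its negative, shows that \<open>L\<close> is injective,
  hence bijective in finite dimension (\<open>operator_bij\<close>). Positivity of \<open>T\<close>, together with that of the
  averaged heat capacity (\<open>avg_heat_capacity_pos\<close>), places the new internal energy above the cold curve,
  and positivity of \<open>E\<close> is the remaining admissibility condition. Density and momentum do not change. The
  total energy is conserved because the exchange terms of the two equations cancel and the column sums of
  the symmetric diffusion matrix vanish (\<open>energy_balance\<close>).
\<close>

section \<open>Strict positivity of the averaged heat capacity\<close>

text \<open>
  Nothing is assumed about the sign of the integrand at the left endpoint, since a heat capacity is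
  only required to be positive at positive temperatures.
\<close>

lemma integral_pos_of_pos:
  fixes f :: "real \<Rightarrow> real"
  assumes f: "f integrable_on {a..b}" and ab: "a < b"
    and pos: "\<And>x. a < x \<Longrightarrow> x \<le> b \<Longrightarrow> 0 < f x"
  shows "0 < integral {a..b} f"
proof -
  let ?S = "{a<..b}"
  have diff: "{a..b} - ?S = {a}" "?S - {a..b} = {}"
    using ab by auto
  have neg: "negligible {x \<in> {a..b} - ?S. f x \<noteq> 0}" "negligible {x \<in> ?S - {a..b}. f x \<noteq> 0}"
    unfolding diff by (auto intro: negligible_subset[of "{a}"])
  have fS: "f integrable_on ?S"
    using integrable_spike_set[OF f] neg by simp
  have eq: "integral {a..b} f = integral ?S f"
    by (rule integral_spike_set) (use neg in auto)
  have abs: "f absolutely_integrable_on ?S"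
    using fS by (rule nonnegative_absolutely_integrable_1) (use pos in \<open>auto intro: less_imp_le\<close>)
  have nonneg: "0 \<le> indicator ?S x *\<^sub>R f x" for x
    using pos[of x] by (auto simp: indicator_def intro: less_imp_le)
  have leb: "integral ?S f = (\<integral>x. indicator ?S x *\<^sub>R f x \<partial>lebesgue)"
    using set_lebesgue_integral_eq_integral(2)[OF abs] by (simp add: set_lebesgue_integral_def)
  have "integral ?S f \<noteq> 0"
  proof
    assume "integral ?S f = 0"
    then have "AE x in lebesgue. indicator ?S x *\<^sub>R f x = 0"
      using integral_nonneg_eq_0_iff_AE[of lebesgue "\<lambda>x. indicator ?S x *\<^sub>R f x"] abs nonneg leb
      by (simp add: set_integrable_def)
    then have "AE x in lebesgue. x \<notin> ?S"
      by eventually_elim (use pos in \<open>force simp: indicator_def split: if_splits\<close>)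
    then have "negligible ?S"
      by (simp add: negligible_iff_null_sets AE_iff_null_sets)
    then show False
      using ab by (simp add: negligible_iff_emeasure0)
  qed
  moreover have "0 \<le> integral ?S f"
    unfolding leb using nonneg by (intro integral_nonneg_AE) simp
  ultimately show ?thesis
    unfolding eq by simp
qed

lemma avg_heat_capacity_pos:
  assumes "g r integrable_on {0..T}" "0 < T" "\<And>\<theta>. 0 < \<theta> \<Longrightarrow> 0 < g r \<theta>"
  shows "0 < avg_heat_capacity g r T"
  using integral_pos_of_pos[of "g r" 0 T] assms by (simp add: avg_heat_capacity_def)

section \<open>The linear radiation exchange system\<close>

lemma exists_min_index:
  fixes E :: "real ^ 'v::finite"
  obtains i where "\<And>j. E $ i \<le> E $ j"
proof -
  have "Min (range (($) E)) \<in> range (($) E)"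
    by (intro Min_in) auto
  then obtain i where "E $ i = Min (range (($) E))"
    by (metis imageE)
  then have "E $ i \<le> E $ j" for j
    by simp
  then show ?thesis
    by (rule that)
qed

text \<open>
  One implicit step of radiation--matter coupling on a finite set of cells. For every cell, \<open>A\<close> is
  the heat capacity per unit volume, \<open>s\<close> the exchange rate (the time step times the absorption cross
  section times the speed of light), \<open>\<beta>\<close> the factor in the linearized emission \<open>\<beta> T\<close>, and \<open>m\<close> the
  mass of the cell; \<open>M\<close> is the time step times the diffusion matrix. The sign of the off-diagonal
  entries and the vanishing row sums are all that the minimum principle needs; symmetry of \<open>M\<close> is
  not required, and the energy balance asks for vanishing column sums instead.
\<close>

locale radiation_exchange =
  fixes A s \<beta> m :: "'v::finite \<Rightarrow> real" and M :: "real ^ 'v ^ 'v"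
  assumes A_pos: "\<And>i. 0 < A i"
    and s_nonneg: "\<And>i. 0 \<le> s i"
    and \<beta>_pos: "\<And>i. 0 < \<beta> i"
    and m_pos: "\<And>i. 0 < m i"
    and offdiag_nonpos: "\<And>i j. i \<noteq> j \<Longrightarrow> M $ i $ j \<le> 0"
    and row_sum: "\<And>i. (\<Sum>j\<in>UNIV. M $ i $ j) = 0"
begin

text \<open>
  The linear part of the system. Its first component collects the material energies and its second
  one the radiation energies; the data of the previous step belong to the right-hand side.
\<close>

definition operator :: "(real ^ 'v) \<times> (real ^ 'v) \<Rightarrow> (real ^ 'v) \<times> (real ^ 'v)"
  where "operator = (\<lambda>(T, E).
    (\<chi> i. A i * T $ i + s i * (\<beta> i * T $ i - E $ i),
     \<chi> i. m i * E $ i + (M *v E) $ i - m i * (s i * (\<beta> i * T $ i - E $ i))))"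

lemma linear_operator: "linear operator"
  by (rule linearI)
     (simp_all add: operator_def case_prod_beta vec_eq_iff matrix_vector_right_distrib
       matrix_vector_mult_scaleR algebra_simps)

lemma diffusion_nonpos_at_min:
  assumes min: "\<And>j. E $ i \<le> E $ j"
  shows "(M *v E) $ i \<le> 0"
proof -
  have "(M *v E) $ i = (\<Sum>j\<in>UNIV. M $ i $ j * (E $ j - E $ i)) + (\<Sum>j\<in>UNIV. M $ i $ j) * E $ i"
    by (simp add: matrix_vector_mult_def sum_distrib_right right_diff_distrib sum_subtractf)
  also have "\<dots> = (\<Sum>j\<in>UNIV. M $ i $ j * (E $ j - E $ i))"
    by (simp add: row_sum)
  also have "\<dots> \<le> 0"
  proof (rule sum_nonpos)
    fix j
    show "M $ i $ j * (E $ j - E $ i) \<le> 0"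
      using min[of j] offdiag_nonpos[of i j] by (cases "i = j") (auto intro: mult_nonpos_nonneg)
  qed
  finally show ?thesis .
qed

text \<open>
  The minimum principle. The first equation of cell \<open>i\<close> is equivalent to
  \<open>(A + s \<beta>) (\<beta> T - E) = \<beta> f - A E\<close>. If \<open>E \<le> 0 \<le> f\<close> there, radiation
  therefore does not lose energy to matter, and at a minimum of \<open>E\<close> it does not lose energy by diffusion
  either.
\<close>

lemma rhs_le_at_nonpos_min:
  assumes sol: "operator (T, E) = (f, g)"
    and min: "\<And>j. E $ i \<le> E $ j" and E: "E $ i \<le> 0" and f: "0 \<le> f $ i"
  shows "g $ i \<le> m i * E $ i"
proof -
  let ?q = "s i * (\<beta> i * T $ i - E $ i)"
  have 1: "A i * T $ i + ?q = f $ i"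
    and 2: "m i * E $ i + (M *v E) $ i - m i * ?q = g $ i"
    using sol by (auto simp: operator_def vec_eq_iff)
  have d: "0 < A i + s i * \<beta> i"
    using A_pos[of i] s_nonneg[of i] \<beta>_pos[of i] by (simp add: add_pos_nonneg)
  \<comment> \<open>The first equation is substituted backwards, so that \<open>T\<close> is replaced by \<open>f\<close>.\<close>
  have "?q * (A i + s i * \<beta> i) = s i * (\<beta> i * (A i * T $ i + ?q) - A i * E $ i)"
    by (simp add: algebra_simps)
  also have "\<dots> = s i * (\<beta> i * f $ i - A i * E $ i)"
    by (simp only: 1)
  also have "\<dots> \<ge> 0"
  proof -
    have "0 \<le> \<beta> i * f $ i" "A i * E $ i \<le> 0"
      using A_pos[of i] \<beta>_pos[of i] f E by (simp_all add: mult_nonneg_nonpos)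
    then show ?thesis
      using s_nonneg[of i] by (intro mult_nonneg_nonneg) auto
  qed
  finally have "0 \<le> ?q"
    using d by (simp add: zero_le_mult_iff)
  then have "0 \<le> m i * ?q"
    by (rule mult_nonneg_nonneg[OF less_imp_le[OF m_pos]])
  then show ?thesis
    using 2 diffusion_nonpos_at_min[of E i, OF min] by linarith
qed

lemma temperature_eq:
  assumes "operator (T, E) = (f, g)"
  shows "T $ i = (f $ i + s i * E $ i) / (A i + s i * \<beta> i)"
proof -
  have "A i * T $ i + s i * (\<beta> i * T $ i - E $ i) = f $ i"
    using assms by (auto simp: operator_def vec_eq_iff)
  moreover have "0 < A i + s i * \<beta> i"
    using A_pos[of i] s_nonneg[of i] \<beta>_pos[of i] by (simp add: add_pos_nonneg)
  ultimately show ?thesis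
    by (simp add: field_simps)
qed

lemma operator_inverse_nonneg:
  assumes sol: "operator (T, E) = (f, g)"
    and f: "\<And>i. 0 \<le> f $ i" and g: "\<And>i. 0 \<le> g $ i"
  shows "0 \<le> T $ i" "0 \<le> E $ i"
proof -
  obtain k where k: "\<And>j. E $ k \<le> E $ j"
    using exists_min_index by blast
  have E: "0 \<le> E $ k"
  proof (rule ccontr)
    assume "\<not> 0 \<le> E $ k"
    then have "m k * E $ k < 0" "g $ k \<le> m k * E $ k"
      using m_pos[of k] rhs_le_at_nonpos_min[OF sol k] f by (auto simp: mult_pos_neg)
    then show False
      using g[of k] by simp
  qed
  then show "0 \<le> E $ i"
    using k[of i] by simp
  then show "0 \<le> T $ i"
    unfolding temperature_eq[OF sol, of i]
    using f[of i] A_pos[of i] s_nonneg[of i] \<beta>_pos[of i] by simp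
qed

lemma operator_inverse_pos:
  assumes sol: "operator (T, E) = (f, g)"
    and f: "\<And>i. 0 < f $ i" and g: "\<And>i. 0 < g $ i"
  shows "0 < T $ i" "0 < E $ i"
proof -
  obtain k where k: "\<And>j. E $ k \<le> E $ j"
    using exists_min_index by blast
  have E: "0 < E $ k"
  proof (rule ccontr)
    assume "\<not> 0 < E $ k"
    then have "m k * E $ k \<le> 0" "g $ k \<le> m k * E $ k"
      using m_pos[of k] rhs_le_at_nonpos_min[OF sol k] f[of k] by (auto simp: mult_nonneg_nonpos)
    then show False
      using g[of k] by simp
  qed
  then show "0 < E $ i"
    using k[of i] by simp
  then show "0 < T $ i"
    unfolding temperature_eq[OF sol, of i]
    using f[of i] A_pos[of i] s_nonneg[of i] \<beta>_pos[of i]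
    by (intro divide_pos_pos add_pos_nonneg) auto
qed

text \<open>
  On the kernel, the right-hand side zero is nonnegative both for \<open>x\<close> and for \<open>- x\<close>, so inverse
  nonnegativity makes the kernel trivial.
\<close>

lemma operator_bij: "bij operator"
proof -
  have "x = 0" if "operator x = 0" for x
  proof -
    have nonneg: "0 \<le> fst y $ i \<and> 0 \<le> snd y $ i" if "operator y = 0" for y i
      using operator_inverse_nonneg[of "fst y" "snd y" 0 0] that by (simp add: zero_prod_def)
    have "operator (- x) = 0"
      using that linear_operator by (simp add: linear_neg)
    then show ?thesis
      using nonneg[of x] nonneg[of "- x"] that
      by (auto simp: prod_eq_iff vec_eq_iff intro: antisym)
  qed
  then have "inj operator"
    using linear_operator by (simp add: linear_injective_0)
  then show ?thesis
    using linear_operator linear_injective_imp_surjective by (auto simp: bij_def)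
qed

text \<open>
  The exchange terms of the two components cancel when the first one is weighted by \<open>m\<close>, and diffusion
  drops out of the sum over all cells.
\<close>

lemma energy_balance:
  assumes sol: "operator (T, E) = (f, g)"
    and column_sum: "\<And>j. (\<Sum>i\<in>UNIV. M $ i $ j) = 0"
  shows "(\<Sum>i\<in>UNIV. m i * (A i * T $ i) + m i * E $ i) = (\<Sum>i\<in>UNIV. m i * f $ i + g $ i)"
proof -
  have "(\<Sum>i\<in>UNIV. (M *v E) $ i) = (\<Sum>j\<in>UNIV. (\<Sum>i\<in>UNIV. M $ i $ j) * E $ j)"
    unfolding matrix_vector_mult_def by (simp add: sum_distrib_right) (rule sum.swap)
  then have zero: "(\<Sum>i\<in>UNIV. (M *v E) $ i) = 0"
    by (simp add: column_sum)
  have "m i * f $ i + g $ i = (m i * (A i * T $ i) + m i * E $ i) + (M *v E) $ i" for i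
  proof -
    have f: "f $ i = A i * T $ i + s i * (\<beta> i * T $ i - E $ i)"
      and g: "g $ i = m i * E $ i + (M *v E) $ i - m i * (s i * (\<beta> i * T $ i - E $ i))"
      using sol by (auto simp: operator_def vec_eq_iff)
    show ?thesis
      unfolding f g by (simp add: algebra_simps)
  qed
  then show ?thesis
    by (simp add: sum.distrib zero)
qed

end

section \<open>The updated states\<close>

lemma material_energy_eq:
  assumes "mass_density u \<noteq> 0"
  shows "material_energy u =
    mass_density u * (internal_energy u + (1/2) * (norm (velocity u))\<^sup>2)"
  using assms by (simp add: internal_energy_def)

lemma updated_state_simps:
  "mass_density (updated_state c_v e_cold U Tstar (T, E) i) = mass_density (U i)"
  "momentum (updated_state c_v e_cold U Tstar (T, E) i) = momentum (U i)"
  "velocity (updated_state c_v e_cold U Tstar (T, E) i) = velocity (U i)"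
  "material_energy (updated_state c_v e_cold U Tstar (T, E) i) =
     mass_density (U i) * (c_v (mass_density (U i)) (Tstar $ i) * T $ i + e_cold (mass_density (U i))
       + (1/2) * (norm (velocity (U i)))\<^sup>2)"
  "radiation_energy (updated_state c_v e_cold U Tstar (T, E) i) = E $ i"
  by (simp_all add: updated_state_def mass_density_def momentum_def velocity_def
      material_energy_def radiation_energy_def Let_def)

lemma internal_energy_updated_state:
  assumes "mass_density (U i) \<noteq> 0"
  shows "internal_energy (updated_state c_v e_cold U Tstar (T, E) i) =
    c_v (mass_density (U i)) (Tstar $ i) * T $ i + e_cold (mass_density (U i))"
  using assms by (simp add: internal_energy_def updated_state_simps)

section \<open>Well-posedness, invariance and conservation of the parabolic update\<close>

theorem lemma5p5:
  fixes b c a_r :: real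
    and e_cold :: "real \<Rightarrow> real"
    and inst_heat_cap c_v Temp \<sigma>_a :: "real \<Rightarrow> real \<Rightarrow> real"
    and stencil :: "'v::finite \<Rightarrow> 'v set"
    and m :: "'v \<Rightarrow> real"
    and K :: "real ^ 'v \<Rightarrow> real ^ 'v \<Rightarrow> real ^ 'v ^ 'v"
    and U :: "'v \<Rightarrow> ('d::finite) state"
    and Tstar :: "real ^ 'v"
  assumes dim: "CARD('d) \<in> {1, 2, 3}"
    and b: "0 \<le> b"
    and c: "0 < c"
    and a_r: "0 < a_r"
    and e_cold: "quasiconcave_on (density_range b) e_cold"
    and heat_cap_pos: "\<forall>r\<in>density_range b. \<forall>\<theta>>0. 0 < inst_heat_cap r \<theta>"
    and heat_cap_integrable: "\<forall>r\<in>density_range b. \<forall>\<theta>>0. inst_heat_cap r integrable_on {0..\<theta>}"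
    and c_v: "c_v = avg_heat_capacity inst_heat_cap"
    and Temp: "\<forall>u \<in> (material_admissible b e_cold :: 'd state set).
        0 \<le> temperature Temp u \<and>
        internal_energy u =
          c_v (mass_density u) (temperature Temp u) * temperature Temp u + e_cold (mass_density u)"
    and sigma_a: "\<forall>r\<in>density_range b. \<forall>\<theta>>0. 0 \<le> \<sigma>_a r \<theta>"
    and stencil_self: "\<forall>i. i \<in> stencil i"
    and stencil_sym: "\<forall>i j. j \<in> stencil i \<longleftrightarrow> i \<in> stencil j"
    and mass: "\<forall>i. 0 < m i"
    and K: "\<forall>r \<theta>. (\<forall>i. r $ i \<in> density_range b) \<and> (\<forall>i. 0 < \<theta> $ i) \<longrightarrow>
        (\<forall>i j. j \<notin> stencil i \<longrightarrow> K r \<theta> $ i $ j = 0) \<and>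
        (\<forall>i j. K r \<theta> $ i $ j = K r \<theta> $ j $ i) \<and>
        (\<forall>i. \<forall>j \<in> stencil i - {i}. K r \<theta> $ i $ j \<le> 0) \<and>
        (\<forall>i. (\<Sum>j\<in>stencil i. K r \<theta> $ i $ j) = 0)"
    and U: "\<forall>i. U i \<in> admissible b e_cold"
    and Tstar: "\<forall>i. 0 < Tstar $ i"
  shows
    "(\<forall>\<tau>>0.
        linear_equation (parabolic_lhs c_v Temp m K \<tau> U Tstar)
          (parabolic_rhs c a_r \<sigma>_a m \<tau> U Tstar) \<and>
        (\<exists>!x. parabolic_lhs c_v Temp m K \<tau> U Tstar x = parabolic_rhs c a_r \<sigma>_a m \<tau> U Tstar x)) \<and>
     (\<forall>\<tau>>0. \<forall>U'. parabolic_update c a_r \<sigma>_a c_v e_cold Temp m K \<tau> Tstar U U' \<longrightarrow>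
        (\<forall>i. U' i \<in> admissible b e_cold)) \<and>
     (\<forall>\<tau>>0. \<forall>U'. parabolic_update c a_r \<sigma>_a c_v e_cold Temp m K \<tau> Tstar U U' \<longrightarrow>
        (\<Sum>i\<in>UNIV. m i * mass_density (U' i)) = (\<Sum>i\<in>UNIV. m i * mass_density (U i)) \<and>
        (\<Sum>i\<in>UNIV. m i *\<^sub>R momentum (U' i)) = (\<Sum>i\<in>UNIV. m i *\<^sub>R momentum (U i)) \<and>
        (\<Sum>i\<in>UNIV. m i * total_energy (U' i)) = (\<Sum>i\<in>UNIV. m i * total_energy (U i)))"
proof -
  \<comment> \<open>\<open>?f\<close> and \<open>?g\<close> are the right-hand side of the system: the thermal part of the old material energy
    per unit volume, and the old radiation energy weighted by the mass.\<close>
  let ?\<rho> = "\<lambda>i. mass_density (U i)"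
  let ?Th = "\<lambda>i. temperature Temp (U i)"
  let ?K = "K (density_vec U) Tstar"
  let ?A = "\<lambda>i. ?\<rho> i * c_v (?\<rho> i) (Tstar $ i)"
  let ?s = "\<lambda>\<tau> i. \<tau> * (\<sigma>_a (?\<rho> i) (Tstar $ i) * c)"
  let ?\<beta> = "\<lambda>i. a_r * Tstar $ i ^ 3"
  let ?f = "(\<chi> i. ?\<rho> i * (c_v (?\<rho> i) (?Th i) * ?Th i)) :: real ^ 'v"
  let ?g = "(\<chi> i. m i * radiation_energy (U i)) :: real ^ 'v"

  have \<rho>_pos: "0 < ?\<rho> i" and \<rho>_range: "?\<rho> i \<in> density_range b"
    and U_mat: "U i \<in> material_admissible b e_cold"
    and U_energy: "e_cold (?\<rho> i) < internal_energy (U i)"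
    and U_rad: "0 < radiation_energy (U i)" for i
    using U[rule_format, of i]
    by (auto simp: admissible_def material_admissible_def density_range_def)
  have U_internal: "internal_energy (U i) = c_v (?\<rho> i) (?Th i) * ?Th i + e_cold (?\<rho> i)" for i
    using Temp U_mat[of i] by blast
  have cv_pos: "0 < c_v (?\<rho> i) (Tstar $ i)" for i
    unfolding c_v using \<rho>_range[of i] Tstar heat_cap_integrable heat_cap_pos
    by (intro avg_heat_capacity_pos) auto
  have A_pos: "0 < ?A i" for i
    using \<rho>_pos cv_pos by simp
  \<comment> \<open>Positivity of \<open>?f\<close> comes from the energy gap above the cold curve, so no strict
    positivity of the old temperature is needed.\<close>
  have f_pos: "0 < ?f $ i" for i
    using U_energy[of i] U_internal[of i] \<rho>_pos[of i] by simp
  have g_pos: "0 < ?g $ i" for i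
    using U_rad[of i] mass by simp

  have Kprops: "\<forall>i j. j \<notin> stencil i \<longrightarrow> ?K $ i $ j = 0"
      "\<forall>i j. ?K $ i $ j = ?K $ j $ i"
      "\<forall>i. \<forall>j \<in> stencil i - {i}. ?K $ i $ j \<le> 0"
      "\<forall>i. (\<Sum>j\<in>stencil i. ?K $ i $ j) = 0"
    using K[rule_format, of "density_vec U" Tstar] \<rho>_range Tstar
    by (simp_all add: density_vec_def)
  have K_offdiag: "?K $ i $ j \<le> 0" if "i \<noteq> j" for i j
    using Kprops(1,3) that by (cases "j \<in> stencil i") auto
  have K_row: "(\<Sum>j\<in>UNIV. ?K $ i $ j) = 0" for i
  proof -
    have "(\<Sum>j\<in>stencil i. ?K $ i $ j) = (\<Sum>j\<in>UNIV. ?K $ i $ j)"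
      using Kprops(1) by (intro sum.mono_neutral_left) auto
    then show ?thesis
      using Kprops(4) by simp
  qed

  have exchange_locale: "radiation_exchange ?A (?s \<tau>) ?\<beta> m (\<tau> *\<^sub>R ?K)" if "0 < \<tau>" for \<tau>
  proof
    fix i j :: 'v
    show "0 < ?A i" by (rule A_pos)
    show "0 \<le> ?s \<tau> i"
      using that c sigma_a \<rho>_range[of i] Tstar by simp
    show "0 < ?\<beta> i"
      using a_r Tstar by simp
    show "0 < m i"
      using mass by simp
    show "(\<tau> *\<^sub>R ?K) $ i $ j \<le> 0" if "i \<noteq> j"
      using K_offdiag[OF that] \<open>0 < \<tau>\<close> by (simp add: mult_nonneg_nonpos)
    show "(\<Sum>j\<in>UNIV. (\<tau> *\<^sub>R ?K) $ i $ j) = 0"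
      using K_row[of i] by (simp flip: sum_distrib_left)
  qed

  let ?L = "\<lambda>\<tau>. radiation_exchange.operator ?A (?s \<tau>) ?\<beta> m (\<tau> *\<^sub>R ?K)"
  let ?lhs = "\<lambda>\<tau>. parabolic_lhs c_v Temp m K \<tau> U Tstar"
  let ?rhs = "\<lambda>\<tau>. parabolic_rhs c a_r \<sigma>_a m \<tau> U Tstar"
  have diff: "?lhs \<tau> x - ?rhs \<tau> x = ?L \<tau> x - (?f, ?g)" if "0 < \<tau>" for \<tau> x
    unfolding radiation_exchange.operator_def[OF exchange_locale[OF that]]
      parabolic_lhs_def parabolic_rhs_def exchange_def case_prod_beta
    by (simp add: prod_eq_iff vec_eq_iff algebra_simps flip: scaleR_matrix_vector_assoc)
  have iff: "?lhs \<tau> x = ?rhs \<tau> x \<longleftrightarrow> ?L \<tau> x = (?f, ?g)" if "0 < \<tau>" for \<tau> x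
    unfolding eq_iff_diff_eq_0[of "?lhs \<tau> x"] eq_iff_diff_eq_0[of "?L \<tau> x"] diff[OF that] ..

  have update: "\<exists>T E. ?L \<tau> (T, E) = (?f, ?g) \<and> U' = updated_state c_v e_cold U Tstar (T, E)"
    if "0 < \<tau>" "parabolic_update c a_r \<sigma>_a c_v e_cold Temp m K \<tau> Tstar U U'" for \<tau> U'
    using that(2) unfolding parabolic_update_def iff[OF that(1)] by auto

  have "linear_equation (?lhs \<tau>) (?rhs \<tau>) \<and> (\<exists>!x. ?lhs \<tau> x = ?rhs \<tau> x)" if "0 < \<tau>" for \<tau>
  proof
    interpret radiation_exchange ?A "?s \<tau>" ?\<beta> m "\<tau> *\<^sub>R ?K"
      by (rule exchange_locale[OF that])
    show "linear_equation (?lhs \<tau>) (?rhs \<tau>)"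
      unfolding linear_equation_def
      by (intro exI conjI allI, rule linear_operator, rule diff[OF that])
    show "\<exists>!x. ?lhs \<tau> x = ?rhs \<tau> x"
      unfolding iff[OF that] by (rule operator_bij[unfolded bij_iff, rule_format])
  qed
  moreover have "U' i \<in> admissible b e_cold"
    if pos: "0 < \<tau>"
      and step: "parabolic_update c a_r \<sigma>_a c_v e_cold Temp m K \<tau> Tstar U U'"
    for \<tau> U' i
  proof -
    interpret radiation_exchange ?A "?s \<tau>" ?\<beta> m "\<tau> *\<^sub>R ?K"
      by (rule exchange_locale[OF pos])
    obtain T E where sol: "operator (T, E) = (?f, ?g)"
      and U': "U' = updated_state c_v e_cold U Tstar (T, E)"
      using update[OF pos step] by blast
    have "0 < T $ i" "0 < E $ i"
      using operator_inverse_pos[OF sol] f_pos g_pos by blast+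
    then show ?thesis
      using \<rho>_pos[of i] \<rho>_range[of i] cv_pos[of i]
      by (simp add: admissible_def material_admissible_def U' updated_state_simps
          internal_energy_updated_state density_range_def)
  qed
  moreover have "(\<Sum>i\<in>UNIV. m i * mass_density (U' i)) = (\<Sum>i\<in>UNIV. m i * mass_density (U i)) \<and>
      (\<Sum>i\<in>UNIV. m i *\<^sub>R momentum (U' i)) = (\<Sum>i\<in>UNIV. m i *\<^sub>R momentum (U i)) \<and>
      (\<Sum>i\<in>UNIV. m i * total_energy (U' i)) = (\<Sum>i\<in>UNIV. m i * total_energy (U i))"
    if pos: "0 < \<tau>"
      and step: "parabolic_update c a_r \<sigma>_a c_v e_cold Temp m K \<tau> Tstar U U'" for \<tau> U'
  proof -
    interpret radiation_exchange ?A "?s \<tau>" ?\<beta> m "\<tau> *\<^sub>R ?K"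
      by (rule exchange_locale[OF pos])
    obtain T E where sol: "operator (T, E) = (?f, ?g)"
      and U': "U' = updated_state c_v e_cold U Tstar (T, E)"
      using update[OF pos step] by blast
    have "(\<Sum>i\<in>UNIV. (\<tau> *\<^sub>R ?K) $ i $ j) = 0" for j
      using row_sum[of j] Kprops(2) by simp
    note balance = energy_balance[OF sol this]
    \<comment> \<open>\<open>?h\<close> is the cold and kinetic part of the material energy, which the update does not change.\<close>
    let ?h = "\<lambda>i. ?\<rho> i * (e_cold (?\<rho> i) + (1/2) * (norm (velocity (U i)))\<^sup>2)"
    have new: "m i * total_energy (U' i) = (m i * (?A i * T $ i) + m i * E $ i) + m i * ?h i" for i
      by (simp add: U' total_energy_def updated_state_simps algebra_simps)
    have old: "m i * total_energy (U i) = (m i * ?f $ i + ?g $ i) + m i * ?h i" for i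
      using \<rho>_pos[of i] U_internal[of i]
      by (simp add: total_energy_def material_energy_eq algebra_simps)
    have "(\<Sum>i\<in>UNIV. m i * total_energy (U' i)) = (\<Sum>i\<in>UNIV. m i * total_energy (U i))"
      unfolding new old sum.distrib[of _ "\<lambda>i. m i * ?h i"] balance ..
    then show ?thesis
      by (simp add: U' updated_state_simps)
  qed
  ultimately show ?thesis
    by blast
qed

end
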